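(* Let $H$ be a Hilbert space, let $\mathcal K\subset H$ be a compact subset with $\sup_{f\in\mathcal K}\|f\|_H=1$, and let $\lambda>1$ be a fixed constant. Then the following hold. (1) Let $\alpha>0$, $\beta\in\mathbb R$, $C>0$. If $e_n(\mathcal K)_H\ge C\,\dfrac{[\log_2n]^\beta}{n^\alpha}$ for all $n=2,3,\ldots$, then there is a constant $C''>0$, independent of $n$, such that $$d_{n-1}(\mathcal K,\lambda^n)_H\ge C''\,\frac{[\log_2n]^{\beta-\alpha}}{n^\alpha},\qquad n=2,3,\ldots.$$ (2) Let $\alpha>0$, $C>0$. If $e_n(\mathcal K)_H\ge C\,\dfrac1{[\log_2n]^\alpha}$ for all $n=2,3,\ldots$, then there is a constant $C''>0$, independent of $n$, such that $$d_{n-1}(\mathcal K,\lambda^n)_H\ge C''\,\frac{1}{[\log_2n]^\alpha},\qquad n=2,3,\ldots.$$ (3) Let $0<\alpha<1$, $C,c>0$. If $e_n(\mathcal K)_H\ge C\,2^{-cn^\alpha}$ for all $n=1,2,\ldots$, then there are constants $C'',c''>0$, independent of $n$, such that $$d_{n-1}(\mathcal K,\lambda^n)_H\ge C''\,2^{-c''n^{\alpha/(1-\alpha)}},\qquad n=2,3,\ldots.$$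
   Context: All linear spaces are over the real numbers. For a compact set $\mathcal K$ in a normed space $X$ the entropy numbers are $$e_n(\mathcal K)_X=\inf\Big\{\epsilon>0:\ \mathcal K\subset\bigcup_{j=1}^{2^n}B(g_j,\epsilon)\ \text{for some } g_1,\ldots,g_{2^n}\in X\Big\},\quad n\ge 0,$$ where $B(g,\epsilon)=\{f\in X:\|f-g\|_X\le\epsilon\}$. For real $N\ge1$ the nonlinear Kolmogorov $(n,N)$-width is $$d_0(\mathcal K,N)_X=\sup_{f\in\mathcal K}\|f\|_X,\qquad d_n(\mathcal K,N)_X=\inf_{\mathcal L_N}\ \sup_{f\in\mathcal K}\ \inf_{X_n\in\mathcal L_N}\operatorname{dist}(f,X_n)_X,\quad n\ge1,$$ where the outer infimum is over all sets $\mathcal L_N$ of at most $N$ linear subspaces $X_n\subset X$ of dimension $n$. The constants $C'',c''$ may depend on $\mathcal K,\lambda,\alpha,\beta,C,c$. *)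

theory Defs
  imports "HOL-Analysis.Analysis"
begin

(* For compact K the set of admissible radii is nonempty and bounded below by 0, so the
   real infimum is the intended one. *)
definition entropy_number :: "nat \<Rightarrow> 'a::real_normed_vector set \<Rightarrow> real" where
  "entropy_number n K =
     Inf {\<epsilon>. \<epsilon> > 0 \<and> (\<exists>g :: nat \<Rightarrow> 'a. K \<subseteq> (\<Union>j\<in>{1..2^n}. cball (g j) \<epsilon>))}"

(* The families of at most N linear subspaces of dimension n, for n > 0. Since dim is 0 on
   infinite-dimensional spaces, dim X = n > 0 forces X to be finite-dimensional. *)
definition subspace_families :: "nat \<Rightarrow> real \<Rightarrow> 'a::real_normed_vector set set set" where
  "subspace_families n N =
     {L. finite L \<and> real (card L) \<le> N \<and> (\<forall>X\<in>L. subspace X \<and> dim X = n)}"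

(* Values are in ennreal so that an infimum over nothing (the empty family, or a space with
   no n-dimensional subspace) is infinite, as usual, rather than an unspecified real. *)
definition nonlinear_width :: "nat \<Rightarrow> 'a::real_normed_vector set \<Rightarrow> real \<Rightarrow> ennreal" where
  "nonlinear_width n K N =
     (if n = 0 then (SUP f\<in>K. ennreal (norm f))
      else (INF L\<in>subspace_families n N. SUP f\<in>K. INF X\<in>L. ennreal (infdist f X)))"

end

theory Submission
  imports Defs "HOL-Real_Asymp.Real_Asymp"
begin

text \<open>
Small widths force small entropy numbers. Suppose that at most \<open>lam ^ n\<close> subspaces of dimension
\<open>n - 1\<close> approximate \<open>K\<close> within \<open>\<delta> \<le> 1\<close>. Since \<open>K\<close> lies in the unit ball, only the ball of radius
\<open>2\<close> of each subspace matters, and rounding coordinates in an orthonormal basis gives a net of that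
ball with at most \<open>(6 * n / \<delta>) ^ (n - 1)\<close> points (\<open>finite_net_of_subspace_ball\<close>). So \<open>K\<close> is covered
by at most \<open>(6 * lam * n / \<delta>) ^ n\<close> balls of radius \<open>2 * \<delta>\<close>, which means that its entropy number of
order \<open>m\<close>, for any \<open>m\<close> above \<open>n * log 2 (6 * lam * n / \<delta>)\<close>, is at most \<open>2 * \<delta>\<close>. Contrapositively,
if that entropy number exceeds \<open>2 * \<delta>\<close>, then the width is at least \<open>\<delta>\<close> (\<open>nonlinear_width_ge\<close>).

It remains to take for \<open>\<delta>\<close> a constant times the claimed rate and to check that the assumed lower
bound for the entropy number of order \<open>m\<close> exceeds \<open>2 * \<delta>\<close>. In the polynomial regime \<open>m\<close> is of
order \<open>n * log 2 n\<close>, which costs the factor \<open>(log 2 n) powr - \<alpha>\<close>. In the logarithmic regime only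
\<open>log 2 m\<close> matters, and it is comparable to \<open>log 2 n\<close>. This regime is the polynomial one with the
exponent of \<open>n\<close> equal to \<open>0\<close>. In both, the constant in front of \<open>\<delta>\<close> enters \<open>m\<close> only
logarithmically, so it can be chosen small enough. In the exponential regime
\<open>log 2 (1 / \<delta>)\<close> is of order \<open>n powr \<gamma>\<close> with \<open>\<gamma> = \<alpha> / (1 - \<alpha>)\<close>, hence \<open>m\<close> is of order
\<open>n powr (1 + \<gamma>)\<close>, and \<open>m powr \<alpha>\<close> is again of order \<open>n powr \<gamma>\<close>. The constant in the exponent of
\<open>\<delta>\<close> enters this estimate with the power \<open>\<alpha> < 1\<close>, so a large value of it works.
\<close>

section \<open>Nets in balls of finite-dimensional subspaces\<close>

text \<open>
The difference of the two sides lies in the span and is orthogonal to it. Because \<open>sgn 0 = 0\<close>,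
a zero vector in \<open>C\<close> contributes nothing, so the output of Gram-Schmidt can serve as an
orthonormal basis as it stands.
\<close>

lemma orthogonal_expansion_sgn:
  fixes C :: "'a::real_inner set"
  assumes "finite C" "pairwise orthogonal C" "x \<in> span C"
  shows "x = (\<Sum>c\<in>C. (x \<bullet> sgn c) *\<^sub>R sgn c)"
proof -
  have sgn_eq: "(v \<bullet> sgn c) *\<^sub>R sgn c = (v \<bullet> c / (c \<bullet> c)) *\<^sub>R c" for v c :: 'a
    by (simp add: sgn_div_norm dot_square_norm power2_eq_square divide_inverse)
  define y where "y = x - (\<Sum>c\<in>C. (x \<bullet> sgn c) *\<^sub>R sgn c)"
  have "y \<bullet> c = 0" if "c \<in> C" for c
  proof -
    have "(\<Sum>d\<in>C. ((x \<bullet> sgn d) *\<^sub>R sgn d) \<bullet> c) = (\<Sum>d\<in>C. if d = c then x \<bullet> c else 0)"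
    proof (rule sum.cong[OF refl])
      fix d assume "d \<in> C"
      then show "((x \<bullet> sgn d) *\<^sub>R sgn d) \<bullet> c = (if d = c then x \<bullet> c else 0)"
        using assms(2) that by (auto simp: sgn_eq pairwise_def orthogonal_def)
    qed
    then show ?thesis
      using assms(1) that by (simp add: y_def inner_diff_left inner_sum_left)
  qed
  moreover have "y \<in> span C"
    unfolding y_def sgn_eq
    by (intro span_diff assms(3) span_sum span_scale span_base)
  ultimately have "orthogonal y y"
    by (metis orthogonal_def orthogonal_to_span)
  then show ?thesis
    by (simp add: y_def orthogonal_self)
qed

text \<open>
Round the coordinates in an orthonormal basis down to multiples of \<open>\<delta> / k\<close>. Each of the at most
\<open>k\<close> coordinates moves by at most \<open>\<delta> / k\<close>, so the triangle inequality bounds the total error by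
\<open>\<delta>\<close>. A volume argument would save the factor \<open>k\<close> in the base of the cardinality bound, but for
the decay rates considered below this factor only changes constants.
\<close>

lemma finite_net_of_subspace_ball:
  fixes X :: "'a::real_inner set"
  assumes "subspace X" "dim X = k" "k > 0" "R > 0" "\<delta> > 0"
  obtains G where "finite G" "real (card G) \<le> (2 * real k * R / \<delta> + 2) ^ k"
    "\<And>x. x \<in> X \<Longrightarrow> norm x \<le> R \<Longrightarrow> \<exists>g\<in>G. dist x g \<le> \<delta>"
proof -
  obtain B where B: "B \<subseteq> X" "independent B" "X \<subseteq> span B" "card B = dim X"
    by (rule basis_exists)
  then have "finite B"
    using assms by (metis card_gt_0_iff)
  then obtain C where C: "finite C" "card C \<le> card B" "span C = span B" "pairwise orthogonal C"
    using basis_orthogonal by blast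
  define h where "h = \<delta> / real k"
  define T where "T = R / h"
  define J where "J = {\<lfloor>- T\<rfloor>..\<lfloor>T\<rfloor>}"
  define p where "p j = (\<Sum>c\<in>C. (h * of_int (j c)) *\<^sub>R sgn c)" for j :: "'a \<Rightarrow> int"
  define G where "G = p ` (\<Pi>\<^sub>E c\<in>C. J)"
  have h: "h > 0" using assms by (simp add: h_def)
  have J: "real (card J) \<le> 2 * real k * R / \<delta> + 2"
  proof -
    have "\<lfloor>- T\<rfloor> \<le> \<lfloor>T\<rfloor>"
      using h assms by (intro floor_mono) (simp add: T_def)
    then have "real (card J) = of_int \<lfloor>T\<rfloor> - of_int \<lfloor>- T\<rfloor> + 1"
      by (simp add: J_def)
    also have "\<dots> \<le> 2 * T + 2"
      by linarith
    also have "T = real k * R / \<delta>"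
      by (simp add: T_def h_def)
    finally show ?thesis by simp
  qed
  have fin_PiE: "finite (\<Pi>\<^sub>E c\<in>C. J)"
    using C(1) by (simp add: J_def finite_PiE)
  then have fin: "finite G"
    by (simp add: G_def)
  have "card G \<le> card (\<Pi>\<^sub>E c\<in>C. J)"
    unfolding G_def using fin_PiE by (rule card_image_le)
  also have "\<dots> = card J ^ card C"
    using C(1) by (simp add: card_PiE)
  finally have "card G \<le> card J ^ card C" .
  then have "real (card G) \<le> real (card J) ^ card C"
    by (metis of_nat_le_iff of_nat_power)
  also have "\<dots> \<le> (2 * real k * R / \<delta> + 2) ^ card C"
    using J by (intro power_mono) auto
  also have "\<dots> \<le> (2 * real k * R / \<delta> + 2) ^ k"
    using C B assms by (intro power_increasing) auto
  finally have card: "real (card G) \<le> (2 * real k * R / \<delta> + 2) ^ k" .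
  have net: "\<exists>g\<in>G. dist x g \<le> \<delta>" if "x \<in> X" "norm x \<le> R" for x
  proof -
    define j where "j = (\<lambda>c\<in>C. \<lfloor>(x \<bullet> sgn c) / h\<rfloor>)"
    have "\<bar>x \<bullet> sgn c\<bar> \<le> R" for c
    proof -
      have "\<bar>x \<bullet> sgn c\<bar> \<le> norm x * norm (sgn c)" by (rule Cauchy_Schwarz_ineq2)
      also have "\<dots> \<le> R" using that assms by (simp add: norm_sgn)
      finally show ?thesis .
    qed
    then have "\<bar>(x \<bullet> sgn c) / h\<bar> \<le> T" for c
      using h by (simp add: T_def divide_right_mono)
    then have "\<lfloor>- T\<rfloor> \<le> \<lfloor>(x \<bullet> sgn c) / h\<rfloor> \<and> \<lfloor>(x \<bullet> sgn c) / h\<rfloor> \<le> \<lfloor>T\<rfloor>" for c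
      by (metis abs_le_iff floor_mono minus_le_iff)
    then have "j c \<in> J" if "c \<in> C" for c
      using that by (simp add: j_def J_def)
    then have "j \<in> (\<Pi>\<^sub>E c\<in>C. J)"
      by (auto simp: j_def)
    then have "p j \<in> G" by (simp add: G_def)
    moreover have "dist x (p j) \<le> \<delta>"
    proof -
      have "x - p j = (\<Sum>c\<in>C. (x \<bullet> sgn c - h * of_int (j c)) *\<^sub>R sgn c)"
      proof -
        have "x \<in> span C" using that B(3) C(3) by blast
        then have "x - p j = (\<Sum>c\<in>C. (x \<bullet> sgn c) *\<^sub>R sgn c) - p j"
          using orthogonal_expansion_sgn[OF C(1,4)] by simp
        then show ?thesis
          by (simp add: p_def scaleR_diff_left sum_subtractf)
      qed
      also have "norm \<dots> \<le> (\<Sum>c\<in>C. h)"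
      proof (rule sum_norm_le)
        fix c assume "c \<in> C"
        have "\<bar>(x \<bullet> sgn c) / h - of_int (j c)\<bar> \<le> 1"
          using \<open>c \<in> C\<close> by (simp add: j_def) linarith
        then have "\<bar>x \<bullet> sgn c - h * of_int (j c)\<bar> \<le> h"
          using h by (simp add: field_simps abs_le_iff)
        then show "norm ((x \<bullet> sgn c - h * of_int (j c)) *\<^sub>R sgn c) \<le> h"
          using h by (simp add: norm_sgn)
      qed
      also have "\<dots> \<le> real k * h"
        using C B assms h by (simp add: mult_right_mono)
      also have "\<dots> = \<delta>" using assms by (simp add: h_def)
      finally show ?thesis by (simp add: dist_norm)
    qed
    ultimately show ?thesis by blast
  qed
  show thesis
    using that[OF fin card net] .
qed

section \<open>Entropy numbers bounded by nonlinear widths\<close>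

lemma entropy_number_le:
  assumes "finite G" "card G \<le> 2 ^ m" "\<epsilon> > 0" "K \<subseteq> (\<Union>g\<in>G. cball g \<epsilon>)"
  shows "entropy_number m K \<le> \<epsilon>"
proof -
  obtain f where "bij_betw f {1..card G} G"
    using ex_bij_betw_nat_finite_1[OF assms(1)] by blast
  then have "G = f ` {1..card G}"
    by (simp add: bij_betw_def)
  also have "\<dots> \<subseteq> f ` {1..2 ^ m}"
    using assms(2) by (intro image_mono) auto
  finally have "G \<subseteq> f ` {1..2 ^ m}" .
  then have "K \<subseteq> (\<Union>j\<in>{1..2 ^ m}. cball (f j) \<epsilon>)"
    using assms(4) by blast
  then show ?thesis
    unfolding entropy_number_def using assms(3)
    by (intro cInf_lower bdd_belowI[where m = 0]) auto
qed

lemma entropy_number_le_1: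
  assumes "\<And>f. f \<in> K \<Longrightarrow> norm f \<le> 1"
  shows "entropy_number n K \<le> 1"
  using assms by (intro entropy_number_le[of "{0}"]) auto

text \<open>
This is an inequality of Carl type. Points of the approximating subspaces that are
\<open>\<delta>\<close>-close to \<open>K\<close> lie in the ball of radius \<open>1 + \<delta> \<le> 2\<close>, and replacing them by points of
\<open>\<delta>\<close>-nets of that ball, one net for each of the at most \<open>N\<close> subspaces, produces a cover of \<open>K\<close>
by balls of radius \<open>2 * \<delta>\<close>.
\<close>

lemma entropy_number_le_of_nonlinear_width_less:
  fixes K :: "'a::real_inner set"
  assumes "k > 0" "0 < \<delta>" "\<delta> \<le> 1" and unit: "\<And>f. f \<in> K \<Longrightarrow> norm f \<le> 1"
    and width: "nonlinear_width k K N < ennreal \<delta>"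
    and count: "N * (6 * real k / \<delta>) ^ k \<le> 2 ^ m"
  shows "entropy_number m K \<le> 2 * \<delta>"
proof -
  obtain L where L: "finite L" "real (card L) \<le> N" "\<And>X. X \<in> L \<Longrightarrow> subspace X \<and> dim X = k"
    and close: "(SUP f\<in>K. INF X\<in>L. ennreal (infdist f X)) < ennreal \<delta>"
    using width \<open>k > 0\<close>
    by (auto simp: nonlinear_width_def INF_less_iff subspace_families_def)
  have "\<exists>G. finite G \<and> real (card G) \<le> (2 * real k * 2 / \<delta> + 2) ^ k \<and>
      (\<forall>x\<in>X. norm x \<le> 2 \<longrightarrow> (\<exists>g\<in>G. dist x g \<le> \<delta>))" if "X \<in> L" for X
    using finite_net_of_subspace_ball[of X k 2 \<delta>] L(3)[OF that] assms
    by (metis zero_less_numeral)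
  then obtain G where G: "\<And>X. X \<in> L \<Longrightarrow> finite (G X)"
    "\<And>X. X \<in> L \<Longrightarrow> real (card (G X)) \<le> (2 * real k * 2 / \<delta> + 2) ^ k"
    "\<And>X x. X \<in> L \<Longrightarrow> x \<in> X \<Longrightarrow> norm x \<le> 2 \<Longrightarrow> \<exists>g\<in>G X. dist x g \<le> \<delta>"
    by metis
  have step: "(2 * real k * 2 / \<delta> + 2) ^ k \<le> (6 * real k / \<delta>) ^ k"
    using assms by (intro power_mono) (auto simp: field_simps)
  have "real (card (\<Union>(G ` L))) \<le> (\<Sum>X\<in>L. real (card (G X)))"
    using card_UN_le[OF L(1), of G] by (metis of_nat_le_iff of_nat_sum)
  also have "\<dots> \<le> (\<Sum>X\<in>L. (6 * real k / \<delta>) ^ k)"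
    using G(2) step by (intro sum_mono) force
  also have "\<dots> \<le> N * (6 * real k / \<delta>) ^ k"
    using L(2) assms by (simp add: mult_right_mono)
  also note count
  finally have "card (\<Union>(G ` L)) \<le> 2 ^ m"
    by (metis of_nat_le_iff of_nat_numeral of_nat_power)
  moreover have "K \<subseteq> (\<Union>g\<in>\<Union>(G ` L). cball g (2 * \<delta>))"
  proof
    fix f assume f: "f \<in> K"
    have "(INF X\<in>L. ennreal (infdist f X)) < ennreal \<delta>"
      using close f by (meson SUP_upper le_less_trans)
    then obtain X where X: "X \<in> L" "infdist f X < \<delta>"
      by (auto simp: INF_less_iff ennreal_less_iff infdist_nonneg)
    then have "X \<noteq> {}" using L(3) subspace_0 by blast
    then obtain x where x: "x \<in> X" "dist f x < \<delta>"
      using X(2) by (auto simp: infdist_notempty cINF_less_iff)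
    have "norm x \<le> norm f + dist f x"
      using norm_triangle_sub[of x f] by (simp add: dist_norm norm_minus_commute)
    then have "norm x \<le> 2" using unit[OF f] x assms by simp
    then obtain g where "g \<in> G X" "dist x g \<le> \<delta>" using G(3) X x by blast
    then have "dist g f \<le> 2 * \<delta>"
      using x(2) dist_triangle[of g f x] by (simp add: dist_commute)
    then show "f \<in> (\<Union>g\<in>\<Union>(G ` L). cball g (2 * \<delta>))"
      using X(1) \<open>g \<in> G X\<close> by auto
  qed
  ultimately show ?thesis
    using entropy_number_le[of "\<Union>(G ` L)" m "2 * \<delta>" K] L(1) G(1) assms by auto
qed

text \<open>
The contrapositive, with dimension \<open>n - 1\<close> and \<open>lam ^ n\<close> subspaces: the number of balls in the
cover is at most \<open>(6 * lam * n / \<delta>) ^ n\<close>, and the condition on \<open>m\<close> says that this does not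
exceed \<open>2 ^ m\<close>.
\<close>

lemma nonlinear_width_ge:
  fixes K :: "'a::real_inner set"
  assumes unit: "\<And>f. f \<in> K \<Longrightarrow> norm f \<le> 1" and "lam > 1" "n \<ge> 2" "0 < \<delta>" "\<delta> \<le> 1"
    and m: "real n * log 2 (6 * lam * real n / \<delta>) \<le> real m"
    and e: "entropy_number m K > 2 * \<delta>"
  shows "ennreal \<delta> \<le> nonlinear_width (n - 1) K (lam ^ n)"
proof (rule ccontr)
  assume "\<not> ?thesis"
  then have w: "nonlinear_width (n - 1) K (lam ^ n) < ennreal \<delta>" by simp
  define t where "t = 6 * real n / \<delta>"
  have t: "1 \<le> t" using assms by (simp add: t_def field_simps)
  have "6 * real (n - 1) / \<delta> \<le> t"
    using assms by (auto simp: t_def intro!: divide_right_mono)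
  then have "(6 * real (n - 1) / \<delta>) ^ (n - 1) \<le> t ^ (n - 1)"
    using assms by (intro power_mono) auto
  also have "\<dots> \<le> t ^ n" using t by (intro power_increasing) auto
  finally have "lam ^ n * (6 * real (n - 1) / \<delta>) ^ (n - 1) \<le> (lam * t) ^ n"
    using assms by (simp add: power_mult_distrib)
  also have "\<dots> = 2 powr (real n * log 2 (lam * t))"
    using t assms by (simp add: powr_realpow[symmetric] powr_powr[symmetric] mult.commute[of "real n"])
  also have "\<dots> \<le> 2 powr real m"
    using m by (intro powr_mono) (auto simp: t_def mult_ac)
  finally have "lam ^ n * (6 * real (n - 1) / \<delta>) ^ (n - 1) \<le> 2 ^ m"
    by (simp add: powr_realpow)
  then show False
    using entropy_number_le_of_nonlinear_width_less[OF _ _ _ unit w, of m] e assms by force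
qed

section \<open>Comparing logarithms and powers with linear functions\<close>

text \<open>
The covering exponent \<open>m\<close> depends on the constant \<open>s\<close> of a hypothetical bound only through
\<open>log 2 (a / s)\<close>. Any power of this logarithm is outgrown by \<open>1 / s\<close> as \<open>s\<close> tends to \<open>0\<close>.
\<close>

lemma small_constant_beats_log_power:
  fixes a b C p :: real
  assumes "a > 0" "C > 0"
  shows "\<forall>\<^sub>F s in at_right 0. 2 * s < C * (4 * (log 2 (a / s) + b)) powr - p"
  using assms by real_asymp

text \<open>
The constant \<open>s\<close> in the exponent of a hypothetical exponential bound returns as
\<open>(M + s) powr \<alpha>\<close> in the entropy estimate, which is sublinear in \<open>s\<close> since \<open>\<alpha> < 1\<close>.
\<close>

lemma large_constant_absorbs:
  fixes c M \<alpha> :: real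
  assumes "c > 0" "0 < \<alpha>" "\<alpha> < 1"
  shows "\<forall>\<^sub>F s in at_top. c * (M + s) powr \<alpha> \<le> s"
  using assms by real_asymp

lemma log2_le_self:
  fixes x :: real
  assumes "x \<ge> 1"
  shows "log 2 x \<le> x"
proof -
  define k where "k = nat \<lfloor>x\<rfloor>"
  have k: "real k \<le> x" "x < real k + 1"
    using assms by (auto simp: k_def)
  have "real k + 1 \<le> 2 ^ k"
    by (induction k) auto
  also have "\<dots> \<le> 2 powr x"
    using k by (simp add: powr_realpow[symmetric])
  finally have "x \<le> 2 powr x"
    using k by simp
  then show ?thesis
    using assms by (simp add: log_le_iff)
qed

section \<open>Lower bounds for widths from decay rates of entropy numbers\<close>

text \<open>
Write \<open>L\<close> for \<open>log 2 n\<close> and let \<open>\<delta>\<close> be \<open>s\<close> times the claimed rate. Then \<open>log 2 (6 * lam * n / \<delta>)\<close>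
is at most \<open>B * L\<close>, where \<open>B\<close> is logarithmic in \<open>1 / s\<close>, hence \<open>m\<close> is of order \<open>B * n * L\<close>
and \<open>log 2 m\<close> lies between \<open>L\<close> and \<open>4 * B * L\<close>. The extra factor \<open>L\<close> in \<open>m\<close> is what turns the
exponent \<open>\<beta>\<close> into \<open>\<beta> - \<alpha>\<close>. All other losses amount to a fixed power of \<open>4 * B\<close>, which a small
\<open>s\<close> compensates. The case \<open>\<alpha> = 0\<close>, where the entropy numbers decay like a power of a logarithm
and nothing is lost in the rate, is covered as well.
\<close>

lemma nonlinear_width_lower_bound_of_polylog_entropy:
  fixes K :: "'a::real_inner set"
  assumes unit: "\<And>f. f \<in> K \<Longrightarrow> norm f \<le> 1" and lam: "lam > 1"
    and \<alpha>: "\<alpha> \<ge> 0" and C: "C > 0"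
    and e: "\<And>n. n \<ge> 2 \<Longrightarrow> C * (log 2 (real n) powr \<beta> / real n powr \<alpha>) \<le> entropy_number n K"
  shows "\<exists>C''>0. \<forall>n\<ge>2. ennreal (C'' * (log 2 (real n) powr (\<beta> - \<alpha>) / real n powr \<alpha>))
                        \<le> nonlinear_width (n - 1) K (lam ^ n)"
proof -
  define q where "q = \<bar>\<beta>\<bar> + \<alpha>"
  define b where "b = 1 + \<alpha> + \<bar>\<alpha> - \<beta>\<bar>"
  have "\<forall>\<^sub>F s in at_right 0. 2 * s < C * (4 * (log 2 (6 * lam / s) + b)) powr - q"
    using lam C by (intro small_constant_beats_log_power) auto
  moreover have "\<forall>\<^sub>F s in at_right 0. s \<in> {0<..<min C 1}"
    using C by (intro eventually_at_right_real) auto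
  ultimately have ev: "\<forall>\<^sub>F s in at_right 0. 2 * s < C * (4 * (log 2 (6 * lam / s) + b)) powr - q
      \<and> s \<in> {0<..<min C 1}"
    by (rule eventually_conj)
  then obtain s where s: "0 < s" "s \<le> C" "s \<le> 1"
    and s_small: "2 * s < C * (4 * (log 2 (6 * lam / s) + b)) powr - q"
    using eventually_happens'[OF _ ev] by (auto simp del: distrib_left_numeral)
  define A where "A = 6 * lam / s"
  define B where "B = log 2 A + b"
  have A: "1 \<le> A"
    using s lam by (simp add: A_def)
  then have logA: "0 \<le> log 2 A"
    by simp
  then have B: "1 \<le> B"
    using \<alpha> by (simp add: B_def b_def)
  have "ennreal (s * (log 2 (real n) powr (\<beta> - \<alpha>) / real n powr \<alpha>))
          \<le> nonlinear_width (n - 1) K (lam ^ n)" if n: "n \<ge> 2" for n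
  proof -
    define L where "L = log 2 (real n)"
    define \<phi> where "\<phi> = L powr (\<beta> - \<alpha>) / real n powr \<alpha>"
    define \<delta> where "\<delta> = s * \<phi>"
    have L: "1 \<le> L" using n by (simp add: L_def)
    have logL: "0 \<le> log 2 L" "log 2 L \<le> L"
      using L log2_le_self by auto
    have \<phi>: "0 < \<phi>" using L n by (simp add: \<phi>_def)
    have \<delta>: "0 < \<delta>" using s \<phi> by (simp add: \<delta>_def)
    \<comment> \<open>The hypothesis together with the trivial bound \<open>1\<close> on entropy numbers controls the rate.\<close>
    have "\<delta> \<le> C * (L powr \<beta> / real n powr \<alpha>)"
      unfolding \<delta>_def \<phi>_def using s L \<alpha> by (intro mult_mono divide_right_mono powr_mono) auto
    also have "\<dots> \<le> 1"
      using e[OF n] entropy_number_le_1[of K n] unit by (simp add: L_def)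
    finally have \<delta>1: "\<delta> \<le> 1" .
    define l where "l = log 2 (6 * lam * real n / \<delta>)"
    define m where "m = nat \<lceil>real n * l\<rceil>"
    have l1: "1 \<le> l"
    proof -
      have "2 * \<delta> \<le> 6 * lam * real n"
        using mult_mono[of 6 "6 * lam" 1 "real n"] lam n \<delta>1 by simp
      then have "2 \<le> 6 * lam * real n / \<delta>"
        using \<delta> by (simp add: le_divide_eq)
      then show ?thesis by (simp add: l_def)
    qed
    have lB: "l \<le> B * L"
    proof -
      have "6 * lam * real n / \<delta> = A * real n * real n powr \<alpha> * L powr (\<alpha> - \<beta>)"
        using s L n by (simp add: A_def \<delta>_def \<phi>_def powr_diff field_simps)
      then have "l = log 2 A + L + \<alpha> * L + (\<alpha> - \<beta>) * log 2 L"
        using A L n by (simp add: l_def log_mult log_powr L_def[symmetric])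
      moreover have "(\<alpha> - \<beta>) * log 2 L \<le> \<bar>\<alpha> - \<beta>\<bar> * L"
        using logL by (intro mult_mono) auto
      moreover have "log 2 A \<le> log 2 A * L"
        using logA L by (simp add: mult_le_cancel_left1)
      ultimately show ?thesis
        by (simp add: B_def b_def algebra_simps)
    qed
    have m_ge: "real n * l \<le> real m"
      by (simp add: m_def real_nat_ceiling_ge)
    have n_le_m: "real n \<le> real m"
      using m_ge l1 n mult_left_mono[of 1 l "real n"] by linarith
    have m_le: "real m \<le> 2 * B * real n * L"
    proof -
      have "0 \<le> real n * l" using l1 by simp
      then have "real m \<le> real n * l + 1" by (simp add: m_def; linarith)
      moreover have "real n * l \<le> real n * (B * L)"
        using lB by (intro mult_left_mono) auto
      moreover have "1 \<le> real n * (B * L)"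
        using n B L mult_mono[of 1 B 1 L] mult_mono[of 1 "real n" 1 "B * L"] by simp
      ultimately show ?thesis by (simp add: mult_ac)
    qed
    have logm_ge: "L \<le> log 2 (real m)"
      using n_le_m n by (simp add: L_def)
    have logm_le: "log 2 (real m) \<le> 4 * B * L"
    proof -
      have "log 2 (real m) \<le> log 2 (2 * B * real n * L)"
        using m_le n_le_m n B L by (subst log_le_cancel_iff) auto
      also have "\<dots> = log 2 (2 * B) + L + log 2 L"
        using B L n by (simp add: log_mult L_def[symmetric])
      also have "\<dots> \<le> 2 * B + L + L"
        using log2_le_self[of "2 * B"] B logL by simp
      also have "\<dots> \<le> 2 * B * L + B * L + B * L"
        using B L by (intro add_mono) auto
      finally show ?thesis by simp
    qed
    \<comment> \<open>The two-sided control of \<open>log 2 m\<close> is needed because \<open>\<beta>\<close> may have either sign.\<close>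
    have log_powr: "L powr \<beta> * (4 * B) powr - \<bar>\<beta>\<bar> \<le> log 2 (real m) powr \<beta>"
    proof (cases "\<beta> \<ge> 0")
      case True
      have "(4 * B) powr - \<bar>\<beta>\<bar> \<le> 1"
        using B powr_mono[of "- \<bar>\<beta>\<bar>" 0 "4 * B"] by simp
      then have "L powr \<beta> * (4 * B) powr - \<bar>\<beta>\<bar> \<le> L powr \<beta>"
        by (simp add: mult_left_le)
      also have "\<dots> \<le> log 2 (real m) powr \<beta>"
        using True L logm_ge by (intro powr_mono2) auto
      finally show ?thesis .
    next
      case False
      then have "(4 * B * L) powr \<beta> \<le> log 2 (real m) powr \<beta>"
        using L logm_ge logm_le by (intro powr_mono2') auto
      then show ?thesis
        using False B L by (simp add: powr_mult mult.commute)
    qed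
    have m_powr: "real m powr \<alpha> \<le> (4 * B) powr \<alpha> * L powr \<alpha> * real n powr \<alpha>"
    proof -
      have "2 * (B * real n * L) \<le> 4 * (B * real n * L)"
        using B L by simp
      then have "real m \<le> 4 * B * L * real n"
        using m_le by (simp add: mult_ac)
      then have "real m powr \<alpha> \<le> (4 * B * L * real n) powr \<alpha>"
        using \<alpha> by (intro powr_mono2) auto
      then show ?thesis
        using B L by (simp add: powr_mult)
    qed
    have "2 * \<delta> < C * (4 * B) powr - q * \<phi>"
      using s_small \<phi> by (simp add: \<delta>_def A_def B_def mult_strict_right_mono)
    also have "\<dots> = C * (L powr \<beta> * (4 * B) powr - \<bar>\<beta>\<bar> /
                          ((4 * B) powr \<alpha> * L powr \<alpha> * real n powr \<alpha>))"
      using B L by (simp add: \<phi>_def q_def powr_diff powr_minus_divide powr_add mult_ac)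
    also have "\<dots> \<le> C * (log 2 (real m) powr \<beta> / real m powr \<alpha>)"
      using C log_powr m_powr n_le_m n by (intro mult_left_mono frac_le) auto
    also have "\<dots> \<le> entropy_number m K"
      using e[of m] n_le_m n by simp
    finally have "2 * \<delta> < entropy_number m K" .
    then show ?thesis
      using nonlinear_width_ge[of K lam n \<delta> m] unit lam n \<delta> \<delta>1 m_ge
      by (simp add: \<delta>_def \<phi>_def L_def l_def)
  qed
  then show ?thesis using s by blast
qed

text \<open>
With \<open>\<gamma> = \<alpha> / (1 - \<alpha>)\<close> and \<open>\<delta> = s * 2 powr (- t * n powr \<gamma>)\<close> the term \<open>t * n powr \<gamma>\<close> dominates
\<open>log 2 (6 * lam * n / \<delta>)\<close>, so \<open>m\<close> is at most \<open>(M + t) * n powr (1 + \<gamma>)\<close>. The exponent \<open>\<gamma>\<close> is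
determined by \<open>(1 + \<gamma>) * \<alpha> = \<gamma>\<close>, which makes \<open>m powr \<alpha>\<close> of order \<open>n powr \<gamma>\<close> again. As \<open>M\<close>
depends on \<open>s\<close>, the constant \<open>s\<close> is fixed first and \<open>t\<close> is chosen large afterwards.
\<close>

lemma nonlinear_width_lower_bound_of_exponential_entropy:
  fixes K :: "'a::real_inner set"
  assumes unit: "\<And>f. f \<in> K \<Longrightarrow> norm f \<le> 1" and lam: "lam > 1"
    and \<alpha>: "0 < \<alpha>" "\<alpha> < 1" and C: "C > 0" and c: "c > 0"
    and e: "\<And>n. n \<ge> 1 \<Longrightarrow> C * 2 powr (- c * real n powr \<alpha>) \<le> entropy_number n K"
  shows "\<exists>C''>0. \<exists>c''>0. \<forall>n\<ge>2. ennreal (C'' * 2 powr (- c'' * real n powr (\<alpha> / (1 - \<alpha>))))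
                        \<le> nonlinear_width (n - 1) K (lam ^ n)"
proof -
  define \<gamma> where "\<gamma> = \<alpha> / (1 - \<alpha>)"
  define s where "s = min 1 (C / 3)"
  define A where "A = 6 * lam / s"
  define M where "M = log 2 A + 1 / (\<gamma> * ln 2) + 1"
  have \<gamma>: "0 < \<gamma>" "(1 + \<gamma>) * \<alpha> = \<gamma>"
    using \<alpha> by (auto simp: \<gamma>_def field_simps)
  have s: "0 < s" "s \<le> 1" "2 * s < C"
    using C by (auto simp: s_def min_def)
  have A: "1 \<le> A"
    using s lam by (simp add: A_def)
  then have logA: "0 \<le> log 2 A"
    by simp
  have "\<forall>\<^sub>F t in at_top. c * (M + t) powr \<alpha> \<le> t \<and> t > 0"
    using large_constant_absorbs[OF c \<alpha>] eventually_gt_at_top by (rule eventually_conj)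
  then obtain t where t: "c * (M + t) powr \<alpha> \<le> t" "t > 0"
    using eventually_happens'[of "at_top :: real filter"] by auto
  have "ennreal (s * 2 powr (- t * real n powr \<gamma>)) \<le> nonlinear_width (n - 1) K (lam ^ n)"
    if n: "n \<ge> 2" for n
  proof -
    define \<delta> where "\<delta> = s * 2 powr (- t * real n powr \<gamma>)"
    define P where "P = real n powr \<gamma>"
    define l where "l = log 2 (6 * lam * real n / \<delta>)"
    define m where "m = nat \<lceil>real n * l\<rceil>"
    have P: "1 \<le> P"
      using n \<gamma> by (simp add: P_def ge_one_powr_ge_zero)
    have \<delta>: "0 < \<delta>" using s by (simp add: \<delta>_def)
    have "2 powr (- t * P) \<le> 1"
      using t P powr_mono[of "- t * P" 0 2] by simp
    then have \<delta>1: "\<delta> \<le> 1"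
      using s mult_mono[of s 1 "2 powr (- t * P)" 1] by (simp add: \<delta>_def P_def)
    have "6 * lam * real n / \<delta> = A * real n * 2 powr (t * P)"
      using s by (simp add: A_def \<delta>_def P_def powr_minus field_simps)
    then have l: "l = log 2 A + log 2 (real n) + t * P"
      using A n by (simp add: l_def log_mult log_powr)
    then have l0: "0 < l"
      using logA n t P by (simp add: add_nonneg_pos)
    have "log 2 (real n) \<le> 1 / (\<gamma> * ln 2) * P"
      using ln_powr_bound[of "real n" \<gamma>] n \<gamma>
      by (simp add: log_def P_def field_simps)
    moreover have "log 2 A \<le> log 2 A * P"
      using logA P by (simp add: mult_le_cancel_left1)
    ultimately have lP: "l + 1 \<le> (M + t) * P"
      using l P by (simp add: M_def algebra_simps)
    have m_ge: "real n * l \<le> real m"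
      by (simp add: m_def real_nat_ceiling_ge)
    have m1: "m \<ge> 1"
    proof -
      have "0 < real n * l" using l0 n by simp
      then show ?thesis using m_ge by linarith
    qed
    have "0 \<le> real n * l" using l0 by simp
    then have "real m \<le> real n * l + 1" by (simp add: m_def; linarith)
    also have "\<dots> \<le> real n * (l + 1)" using n by (simp add: algebra_simps)
    also have "\<dots> \<le> real n * ((M + t) * P)"
      using lP by (intro mult_left_mono) auto
    also have "\<dots> = (M + t) * real n powr (1 + \<gamma>)"
      using n by (simp add: P_def powr_add)
    finally have "real m powr \<alpha> \<le> ((M + t) * real n powr (1 + \<gamma>)) powr \<alpha>"
      using \<alpha> by (intro powr_mono2) auto
    also have "\<dots> = (M + t) powr \<alpha> * P"
      using logA \<gamma> t by (simp add: M_def powr_mult powr_powr P_def)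
    finally have "c * real m powr \<alpha> \<le> c * (M + t) powr \<alpha> * P"
      using c by simp
    also have "\<dots> \<le> t * P"
      using t P by (intro mult_right_mono) auto
    finally have cm: "c * real m powr \<alpha> \<le> t * P" .
    have "2 * \<delta> < C * 2 powr (- t * P)"
      using s by (simp add: \<delta>_def P_def)
    also have "\<dots> \<le> C * 2 powr (- c * real m powr \<alpha>)"
      using C cm by (intro mult_left_mono powr_mono) auto
    also have "\<dots> \<le> entropy_number m K"
      using e[OF m1] .
    finally have "2 * \<delta> < entropy_number m K" .
    then show ?thesis
      using nonlinear_width_ge[of K lam n \<delta> m] unit lam n \<delta> \<delta>1 m_ge
      by (simp add: \<delta>_def l_def)
  qed
  then show ?thesis using s t unfolding \<gamma>_def by blast
qed

section \<open>The three decay regimes\<close>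

theorem corollary4p4:
  fixes K :: "'a::{real_inner, complete_space} set" and lam :: real
  assumes "compact K" and "K \<noteq> {}" and "(SUP f\<in>K. norm f) = 1" and "lam > 1"
  shows
    "(\<forall>\<alpha> \<beta> C :: real. \<alpha> > 0 \<longrightarrow> C > 0 \<longrightarrow>
        (\<forall>n::nat. n \<ge> 2 \<longrightarrow>
           entropy_number n K \<ge> C * ((log 2 (real n) powr \<beta>) / (real n powr \<alpha>))) \<longrightarrow>
        (\<exists>C'' :: real. C'' > 0 \<and> (\<forall>n::nat. n \<ge> 2 \<longrightarrow>
           nonlinear_width (n - 1) K (lam ^ n) \<ge>
             ennreal (C'' * ((log 2 (real n) powr (\<beta> - \<alpha>)) / (real n powr \<alpha>))))))
     \<and>
     (\<forall>\<alpha> C :: real. \<alpha> > 0 \<longrightarrow> C > 0 \<longrightarrow>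
        (\<forall>n::nat. n \<ge> 2 \<longrightarrow>
           entropy_number n K \<ge> C * (1 / (log 2 (real n) powr \<alpha>))) \<longrightarrow>
        (\<exists>C'' :: real. C'' > 0 \<and> (\<forall>n::nat. n \<ge> 2 \<longrightarrow>
           nonlinear_width (n - 1) K (lam ^ n) \<ge>
             ennreal (C'' * (1 / (log 2 (real n) powr \<alpha>))))))
     \<and>
     (\<forall>\<alpha> C c :: real. 0 < \<alpha> \<longrightarrow> \<alpha> < 1 \<longrightarrow> C > 0 \<longrightarrow> c > 0 \<longrightarrow>
        (\<forall>n::nat. n \<ge> 1 \<longrightarrow>
           entropy_number n K \<ge> C * 2 powr (- c * (real n powr \<alpha>))) \<longrightarrow>
        (\<exists>C'' c'' :: real. C'' > 0 \<and> c'' > 0 \<and> (\<forall>n::nat. n \<ge> 2 \<longrightarrow>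
           nonlinear_width (n - 1) K (lam ^ n) \<ge>
             ennreal (C'' * 2 powr (- c'' * (real n powr (\<alpha> / (1 - \<alpha>))))))))"
proof -
  have unit: "norm f \<le> 1" if "f \<in> K" for f
  proof -
    have "bdd_above (norm ` K)"
      using \<open>compact K\<close> by (meson bounded_imp_bdd_above compact_continuous_image
          compact_imp_bounded continuous_on_norm_id)
    then show ?thesis
      using that assms(3) by (metis cSUP_upper)
  qed
  show ?thesis
  proof (intro conjI allI impI, goal_cases)
    case (1 \<alpha> \<beta> C)
    then show ?case
      using nonlinear_width_lower_bound_of_polylog_entropy[of K lam \<alpha> C \<beta>] unit \<open>lam > 1\<close> by simp
  next
    case (2 \<alpha> C)
    \<comment> \<open>A purely logarithmic rate is a polylogarithmic one with polynomial exponent \<open>0\<close>.\<close>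
    have "1 / log 2 (real n) powr \<alpha> = log 2 (real n) powr - \<alpha> / real n powr 0" if "n \<ge> 2" for n :: nat
      using that by (simp add: powr_minus_divide)
    then show ?case
      using nonlinear_width_lower_bound_of_polylog_entropy[of K lam 0 C "- \<alpha>"] unit \<open>lam > 1\<close> 2 by simp
  next
    case (3 \<alpha> C c)
    then show ?case
      using nonlinear_width_lower_bound_of_exponential_entropy[of K lam \<alpha> C c] unit \<open>lam > 1\<close> by simp
  qed
qed

end
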